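(* Let $n\geq 1$ and let $w\in F_n$ be a non-empty cyclically reduced word of length $k$ that is not a proper power, and suppose that some shift $\theta^{j}(w)$ ($0\leq j<n$) of $w$ is equal to $\phi^t(w)$ for some $0\leq t<k$. Then there exists $0\leq h<n$ such that \[w=\prod_{i=0}^{n/(n,h)-1}\theta^{ih}(u),\] where $u$ is the initial subword of $w$ of length $(k,t)$.
   Context: $F_n$ is the free group with basis $x_0,\ldots,x_{n-1}$; subscripts are taken modulo $n$. $\theta:F_n\to F_n$ is the shift automorphism $\theta(x_i)=x_{i+1}$; the shifts of $w$ are the words $\theta^i(w)$, $0\leq i<n$. $\phi$ is the function that cyclically permutes a cyclically reduced word by one letter (moving its first letter, a generator or inverse of a generator, to the end). $(a,b)$ denotes the greatest common divisor, with $(a,0)=a$. The product is the ordered product $u\,\theta^h(u)\,\theta^{2h}(u)\cdots$. A word is a proper power if it equals $v^p$ for some $v\in F_n$ and $p\geq 2$. Equality of words means equality in $F_n$. *)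

theory Defs
  imports "HOL-Algebra.Group"
begin

text \<open>
  A letter is a basis element \<open>(True, a)\<close> or the formal inverse \<open>(False, a)\<close> of one. The free
  group on \<open>S\<close> is realised on the reduced words over \<open>S\<close>, so that equality in the group is
  equality of lists; \<open>free_group_is_group\<close> and \<open>free_group_universal\<close> below confirm that it is
  the free group with basis \<open>S\<close>.
\<close>

type_synonym 'a word = "(bool \<times> 'a) list"

definition inv_letter :: "bool \<times> 'a \<Rightarrow> bool \<times> 'a" where
  "inv_letter = apfst Not"

definition reduced :: "'a word \<Rightarrow> bool" where
  "reduced w \<longleftrightarrow> successively (\<lambda>x y. y \<noteq> inv_letter x) w"

definition cyclically_reduced :: "'a word \<Rightarrow> bool" where
  "cyclically_reduced w \<longleftrightarrow> reduced w \<and> (w \<noteq> [] \<longrightarrow> hd w \<noteq> inv_letter (last w))"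

fun push_letter :: "bool \<times> 'a \<Rightarrow> 'a word \<Rightarrow> 'a word" where
  "push_letter x [] = [x]"
| "push_letter x (y # w) = (if y = inv_letter x then w else x # y # w)"

text \<open>For reduced \<open>v\<close>, \<open>foldr push_letter u v\<close> is the reduced form of the concatenation \<open>u @ v\<close>.\<close>

definition free_group :: "'a set \<Rightarrow> 'a word monoid" where
  "free_group S =
     \<lparr>carrier = {w. reduced w \<and> snd ` set w \<subseteq> S},
      monoid.mult = (\<lambda>u v. foldr push_letter u v),
      one = []\<rparr>"

abbreviation F :: "nat \<Rightarrow> nat word monoid" where
  "F n \<equiv> free_group {..<n}"

definition shift :: "nat \<Rightarrow> nat word \<Rightarrow> nat word" where
  "shift n = map (apsnd (\<lambda>i. (i + 1) mod n))"

definition proper_power :: "('a, 'b) monoid_scheme \<Rightarrow> 'a \<Rightarrow> bool" where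
  "proper_power G w \<longleftrightarrow> (\<exists>v \<in> carrier G. \<exists>p::nat. p \<ge> 2 \<and> w = v [^]\<^bsub>G\<^esub> p)"

lemma inv_letter_simps [simp]:
  "inv_letter (inv_letter x) = x" "snd (inv_letter x) = snd x" "inv_letter x \<noteq> x"
  "inv_letter (b, a) = (\<not> b, a)" "x = inv_letter y \<longleftrightarrow> inv_letter x = y"
  by (cases x; cases y; auto simp: inv_letter_def)+

lemma reduced_simps [simp]:
  "reduced []" "reduced [x]"
  "reduced (x # y # w) \<longleftrightarrow> y \<noteq> inv_letter x \<and> reduced (y # w)"
  by (auto simp: reduced_def)

lemma reduced_ConsD: "reduced (x # w) \<Longrightarrow> reduced w"
  by (cases w) auto

lemma push_letter_reduced: "reduced w \<Longrightarrow> reduced (push_letter x w)"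
  by (cases w) (auto dest: reduced_ConsD)

lemma push_letter_Cons: "reduced (x # w) \<Longrightarrow> push_letter x w = x # w"
  by (cases w) auto

lemma push_letter_cancel: "reduced w \<Longrightarrow> push_letter x (push_letter (inv_letter x) w) = w"
  by (cases w; cases "tl w") auto

lemma set_push_letter: "set (push_letter x w) \<subseteq> insert x (set w)"
  by (cases w) auto

lemma foldr_push_reduced: "reduced v \<Longrightarrow> reduced (foldr push_letter u v)"
  by (induction u) (auto intro: push_letter_reduced)

lemma set_foldr_push: "set (foldr push_letter u v) \<subseteq> set u \<union> set v"
proof (induction u)
  case (Cons x u)
  then show ?case using set_push_letter[of x "foldr push_letter u v"] by auto
qed simp

lemma foldr_push_Nil: "reduced u \<Longrightarrow> foldr push_letter u [] = u"
proof (induction u)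
  case (Cons x u)
  then show ?case using reduced_ConsD[OF Cons.prems] by (simp add: push_letter_Cons)
qed simp

lemma foldr_push_push:
  assumes "reduced w"
  shows "foldr push_letter (push_letter x u) w = push_letter x (foldr push_letter u w)"
proof (cases u)
  case (Cons y v)
  then show ?thesis
    using push_letter_cancel[OF foldr_push_reduced[OF assms], of x v] by auto
qed simp

lemma foldr_push_assoc:
  "reduced w \<Longrightarrow>
   foldr push_letter (foldr push_letter u v) w = foldr push_letter u (foldr push_letter v w)"
  by (induction u) (auto simp: foldr_push_push)

lemma foldr_push_inv:
  "reduced v \<Longrightarrow> foldr push_letter (rev (map inv_letter u)) (foldr push_letter u v) = v"
proof (induction u arbitrary: v)
  case (Cons x u)
  then show ?case
    using push_letter_cancel[OF foldr_push_reduced[OF Cons.prems], of "inv_letter x" u] by simp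
qed simp

lemma reduced_rev_inv: "reduced u \<Longrightarrow> reduced (rev (map inv_letter u))"
  unfolding reduced_def successively_rev successively_map
  by (erule successively_mono) auto

theorem free_group_is_group: "group (free_group S)"
proof (rule groupI)
  fix u assume u: "u \<in> carrier (free_group S)"
  have "foldr push_letter (rev (map inv_letter u)) u = []"
    using u foldr_push_inv[of "[]" u] by (simp add: free_group_def foldr_push_Nil)
  moreover have "rev (map inv_letter u) \<in> carrier (free_group S)"
    using u by (simp add: free_group_def reduced_rev_inv image_image)
  ultimately show "\<exists>v \<in> carrier (free_group S). v \<otimes>\<^bsub>free_group S\<^esub> u = \<one>\<^bsub>free_group S\<^esub>"
    by (intro bexI[of _ "rev (map inv_letter u)"]) (auto simp: free_group_def)
next
  fix u v assume "u \<in> carrier (free_group S)" "v \<in> carrier (free_group S)"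
  then show "u \<otimes>\<^bsub>free_group S\<^esub> v \<in> carrier (free_group S)"
    using set_foldr_push[of u v] by (fastforce simp: free_group_def foldr_push_reduced)
qed (auto simp: free_group_def foldr_push_assoc)

theorem free_group_universal:
  assumes "group G" and f: "f \<in> S \<rightarrow> carrier G"
  shows "\<exists>h \<in> hom (free_group S) G. (\<forall>a \<in> S. h [(True, a)] = f a) \<and>
           (\<forall>h' \<in> hom (free_group S) G. (\<forall>a \<in> S. h' [(True, a)] = f a) \<longrightarrow>
              (\<forall>w \<in> carrier (free_group S). h' w = h w))"
proof -
  interpret G: group G by fact
  interpret FS: group "free_group S" by (rule free_group_is_group)
  define val where "val x = (if fst x then f (snd x) else inv\<^bsub>G\<^esub> f (snd x))" for x
  define h where "h w = foldr (\<lambda>x g. val x \<otimes>\<^bsub>G\<^esub> g) w \<one>\<^bsub>G\<^esub>" for w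
  have val: "val x \<in> carrier G" "val x \<otimes>\<^bsub>G\<^esub> val (inv_letter x) = \<one>\<^bsub>G\<^esub>" if "snd x \<in> S" for x
    using that f by (cases x; auto simp: val_def Pi_iff)+
  have h_closed: "h w \<in> carrier G" if "snd ` set w \<subseteq> S" for w
    using that by (induction w) (auto simp: h_def val)
  have h_push: "h (push_letter x w) = val x \<otimes>\<^bsub>G\<^esub> h w" if "snd x \<in> S" "snd ` set w \<subseteq> S" for x w
  proof (cases "w \<noteq> [] \<and> hd w = inv_letter x")
    case True
    then obtain w' where w: "w = inv_letter x # w'" by (cases w) auto
    have "val x \<otimes>\<^bsub>G\<^esub> h w = (val x \<otimes>\<^bsub>G\<^esub> val (inv_letter x)) \<otimes>\<^bsub>G\<^esub> h w'"
      using that w val(1)[of x] val(1)[of "inv_letter x"] h_closed[of w']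
      by (simp add: h_def G.m_assoc)
    then show ?thesis using that w h_closed[of w'] by (simp add: val(2))
  next
    case False
    then show ?thesis by (cases w) (auto simp: h_def)
  qed
  have h_mult: "h (foldr push_letter u v) = h u \<otimes>\<^bsub>G\<^esub> h v"
    if "snd ` set u \<subseteq> S" "snd ` set v \<subseteq> S" for u v
    using that(1)
  proof (induction u)
    case Nil
    then show ?case using h_closed[OF that(2)] by (simp add: h_def)
  next
    case (Cons x u)
    have "snd ` set (foldr push_letter u v) \<subseteq> S"
      using Cons.prems that(2) set_foldr_push[of u v] by fastforce
    then have "h (foldr push_letter (x # u) v) = val x \<otimes>\<^bsub>G\<^esub> (h u \<otimes>\<^bsub>G\<^esub> h v)"
      using Cons by (simp add: h_push)
    also have "\<dots> = (val x \<otimes>\<^bsub>G\<^esub> h u) \<otimes>\<^bsub>G\<^esub> h v"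
      using Cons.prems that(2) by (simp add: G.m_assoc val h_closed)
    finally show ?case by (simp add: h_def)
  qed
  have hom: "h \<in> hom (free_group S) G"
    by (auto simp: hom_def free_group_def h_mult h_closed)
  have basis: "h [(True, a)] = f a" if "a \<in> S" for a
    using that f by (auto simp: h_def val_def Pi_iff)
  have uniq: "h' w = h w"
    if h': "h' \<in> hom (free_group S) G" "\<forall>a \<in> S. h' [(True, a)] = f a"
      and "w \<in> carrier (free_group S)" for h' w
    using that(3)
  proof (induction w)
    case Nil
    have "h' \<one>\<^bsub>free_group S\<^esub> = \<one>\<^bsub>G\<^esub>"
      using h'(1) by (simp add: hom_one[OF h'(1) FS.group_axioms G.group_axioms])
    then show ?case by (simp add: free_group_def h_def)
  next
    case (Cons x w)
    obtain b a where x: "x = (b, a)" by (cases x)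
    have a: "a \<in> S" and w: "w \<in> carrier (free_group S)"
      using Cons.prems x by (auto simp: free_group_def dest: reduced_ConsD)
    have pos: "[(True, a)] \<in> carrier (free_group S)" and neg: "[(False, a)] \<in> carrier (free_group S)"
      using a by (auto simp: free_group_def)
    have "inv\<^bsub>free_group S\<^esub> [(True, a)] = [(False, a)]"
      by (rule FS.inv_equality[OF _ pos neg]) (simp add: free_group_def)
    then have "h' [(False, a)] = inv\<^bsub>G\<^esub> f a"
      using h' a pos group_hom.hom_inv[of "free_group S" G h' "[(True, a)]"]
      by (simp add: group_hom_def group_hom_axioms_def FS.group_axioms G.group_axioms)
    then have x': "h' [x] = val x" using h'(2) a x by (cases b) (auto simp: val_def)
    have "x # w = [x] \<otimes>\<^bsub>free_group S\<^esub> w"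
      using Cons.prems by (simp add: free_group_def push_letter_Cons)
    moreover have "[x] \<in> carrier (free_group S)" using pos neg x by (cases b) auto
    ultimately have "h' (x # w) = val x \<otimes>\<^bsub>G\<^esub> h' w"
      using hom_mult[OF h'(1) _ w, of "[x]"] x' by simp
    then show ?case using Cons.IH[OF w] by (simp add: h_def)
  qed
  show ?thesis using hom basis uniq by blast
qed

lemma shift_simps [simp]:
  "shift n [] = []" "shift n ((b, i) # w) = (b, (i + 1) mod n) # shift n w"
  by (simp_all add: shift_def)

lemma snd_set_shift:
  assumes "n \<ge> 1" shows "snd ` set (shift n w) \<subseteq> {..<n}"
  using assms by (auto simp: shift_def)

lemma add_one_mod_eq_iff:
  assumes "i < n" "i' < n" shows "Suc i mod n = Suc i' mod n \<longleftrightarrow> i = i'"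
  using assms by (auto simp: mod_Suc split: if_splits)

lemma shift_push:
  assumes "snd x < n" "snd ` set w \<subseteq> {..<n}"
  shows "shift n (push_letter x w) = push_letter (apsnd (\<lambda>i. (i + 1) mod n) x) (shift n w)"
  using assms by (cases x; cases w) (auto simp: add_one_mod_eq_iff split: if_splits)

lemma shift_reduced:
  assumes "reduced w" "snd ` set w \<subseteq> {..<n}" shows "reduced (shift n w)"
  using assms
proof (induction w rule: induct_list012)
  case (3 x y w)
  then show ?case by (cases x; cases y) (auto simp: add_one_mod_eq_iff)
qed (auto simp: shift_def)

theorem shift_iso:
  assumes "n \<ge> 1" shows "shift n \<in> iso (F n) (F n)"
proof -
  have closed: "shift n w \<in> carrier (F n)" if "w \<in> carrier (F n)" for w
    using that snd_set_shift[OF assms, of w] by (auto simp: free_group_def shift_reduced)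
  have "shift n (foldr push_letter u v) = foldr push_letter (shift n u) (shift n v)"
    if "snd ` set u \<subseteq> {..<n}" "snd ` set v \<subseteq> {..<n}" for u v
    using that(1)
  proof (induction u)
    case (Cons x u)
    have "snd ` set (foldr push_letter u v) \<subseteq> {..<n}"
      using Cons.prems that(2) set_foldr_push[of u v] by fastforce
    then show ?case using Cons by (cases x) (simp add: shift_push)
  qed simp
  then have hom: "shift n \<in> hom (F n) (F n)"
    using closed by (auto simp: hom_def) (auto simp: free_group_def)
  have pow: "(shift n ^^ m) w = map (apsnd (\<lambda>i. (i + m) mod n)) w"
    if "w \<in> carrier (F n)" for m w
  proof (induction m)
    case 0
    then show ?case using that
      by (auto simp: free_group_def apsnd_def map_prod_def image_subset_iff intro!: map_idI[symmetric])
  next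
    case (Suc m)
    then show ?case by (auto simp: shift_def mod_Suc_eq)
  qed
  have id: "(shift n ^^ n) w = w" if "w \<in> carrier (F n)" for w
    using that pow[OF that, of n] by (force simp: free_group_def intro!: map_idI)
  have pow_closed: "(shift n ^^ m) w \<in> carrier (F n)" if "w \<in> carrier (F n)" for m w
    using that by (induction m) (auto intro: closed)
  have "bij_betw (shift n) (carrier (F n)) (carrier (F n))"
  proof (rule bij_betw_byWitness[where f' = "shift n ^^ (n - 1)"])
    have "shift n ^^ n = shift n \<circ> shift n ^^ (n - 1)" "shift n ^^ n = shift n ^^ (n - 1) \<circ> shift n"
      using assms funpow.simps(2)[of "n - 1" "shift n"] funpow_Suc_right[of "n - 1" "shift n"]
      by simp_all
    then show "\<forall>w \<in> carrier (F n). (shift n ^^ (n - 1)) (shift n w) = w"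
      "\<forall>w \<in> carrier (F n). shift n ((shift n ^^ (n - 1)) w) = w"
      using id by (metis comp_apply)+
  qed (use closed pow_closed in auto)
  with hom show ?thesis by (simp add: iso_def)
qed

end

theory Submission
  imports Defs "HOL-Number_Theory.Cong"
begin

text \<open>
  Write \<open>d = gcd k t\<close> and \<open>d \<equiv> a t (mod k)\<close>. Since the shift commutes with cyclic permutation,
  \<open>\<theta>\<^sup>h(w) = \<phi>\<^sup>d(w)\<close> for \<open>h = j a mod n\<close>, so \<open>w\<close> is the concatenation of the \<open>k/d\<close> blocks
  \<open>\<theta>\<^bsup>ih\<^esup>(u)\<close>. Going round once, \<open>\<theta>\<^bsup>hk/d\<^esup>(w) = w\<close>, and a power of the shift fixes a non-empty
  word only if it is trivial; hence \<open>n/(n,h)\<close> divides \<open>k/d\<close>. The blocks repeat with period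
  \<open>n/(n,h)\<close>, so \<open>w\<close> is a power with exponent the quotient, which must therefore be \<open>1\<close>.
\<close>

lemma reduced_append1: "reduced (u @ v) \<Longrightarrow> reduced u"
  and reduced_append2: "reduced (u @ v) \<Longrightarrow> reduced v"
  by (auto simp: reduced_def successively_append_iff)

lemma mult_free_group: "u \<otimes>\<^bsub>free_group S\<^esub> v = foldr push_letter u v"
  and one_free_group: "\<one>\<^bsub>free_group S\<^esub> = []"
  by (simp_all add: free_group_def)

lemma foldr_push_append: "reduced (u @ v) \<Longrightarrow> foldr push_letter u v = u @ v"
proof (induction u)
  case (Cons x u)
  then show ?case using reduced_ConsD[of x "u @ v"] by (simp add: push_letter_Cons)
qed simp

text \<open>If the whole concatenation is reduced, nothing cancels between factors, so the group
  product is plain list concatenation. The main argument can then work with lists alone.\<close>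

lemma mult_list_eq_concat:
  assumes "reduced (concat ws)"
  shows "foldr (\<lambda>a b. a \<otimes>\<^bsub>free_group S\<^esub> b) ws \<one>\<^bsub>free_group S\<^esub> = concat ws"
  using assms
proof (induction ws)
  case (Cons u ws)
  then have "reduced (u @ concat ws)" by simp
  with Cons.IH[OF reduced_append2[OF this]] show ?case
    by (simp add: mult_free_group foldr_push_append)
qed (simp add: one_free_group)

lemma nat_pow_eq_concat_replicate:
  assumes "reduced (concat (replicate q v))"
  shows "v [^]\<^bsub>free_group S\<^esub> q = concat (replicate q v)"
  using assms
proof (induction q)
  case (Suc q)
  have eq: "concat (replicate (Suc q) v) = concat (replicate q v) @ v"
    by (simp flip: replicate_append_same)
  with Suc show ?case
    by (simp add: mult_free_group foldr_push_append reduced_append1 del: replicate.simps)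
qed (simp add: one_free_group)

lemma shift_funpow_conv_map:
  assumes "w \<in> carrier (F n)"
  shows "(shift n ^^ m) w = map (apsnd (\<lambda>i. (i + m) mod n)) w"
proof (induction m)
  case 0
  then show ?case using assms
    by (auto simp: free_group_def apsnd_def map_prod_def image_subset_iff intro!: map_idI[symmetric])
next
  case (Suc m)
  then show ?case by (auto simp: shift_def mod_Suc_eq)
qed

lemma shift_funpow_cong:
  assumes "w \<in> carrier (F n)" "[m = m'] (mod n)"
  shows "(shift n ^^ m) w = (shift n ^^ m') w"
proof -
  have "(i + m) mod n = (i + m') mod n" for i
    using assms(2) by (metis cong_def mod_add_right_eq)
  then show ?thesis by (simp add: shift_funpow_conv_map[OF assms(1)])
qed

text \<open>The first letter decides: its index \<open>i < n\<close> moves to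
  \<open>(i + m) mod n\<close>, which is \<open>i\<close> only if \<open>n\<close> divides
  \<open>m\<close>.\<close>

lemma shift_funpow_fix_imp_dvd:
  assumes "w \<in> carrier (F n)" "w \<noteq> []" "(shift n ^^ m) w = w"
  shows "n dvd m"
proof -
  obtain b i w' where w: "w = (b, i) # w'" using assms(2) by (cases w) auto
  have "i < n" using assms(1) w by (simp add: free_group_def)
  moreover have "(i + m) mod n = i"
    using assms(3) unfolding shift_funpow_conv_map[OF assms(1)] by (simp add: w)
  ultimately have "[i + m = i] (mod n)" by (simp add: cong_def)
  then have "[m = 0] (mod n)" by (metis add.right_neutral cong_add_lcancel_nat)
  then show ?thesis by (simp add: cong_0_iff)
qed

lemma shift_rotate: "(shift n ^^ m) (rotate t w) = rotate t ((shift n ^^ m) w)"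
  by (induction m) (auto simp: shift_def rotate_map)

lemma take_shift: "take d ((shift n ^^ m) w) = (shift n ^^ m) (take d w)"
  by (induction m) (auto simp: shift_def take_map)

text \<open>Shifts act letterwise and so commute with rotation; each further
  \<open>shift n ^^ j\<close> therefore adds \<open>t\<close> to the rotation.\<close>

lemma shift_eq_rotate_mult:
  assumes "(shift n ^^ j) w = rotate t w"
  shows "(shift n ^^ (a * j)) w = rotate (a * t) w"
proof (induction a)
  case (Suc a)
  have "(shift n ^^ (Suc a * j)) w = (shift n ^^ (a * j)) ((shift n ^^ j) w)"
    by (metis add.commute comp_apply funpow_add mult_Suc)
  also have "\<dots> = rotate (Suc a * t) w"
    by (simp add: assms shift_rotate Suc rotate_rotate)
  finally show ?case .
qed simp

lemma concat_blocks:
  assumes "length w = d * m"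
  shows "concat (map (\<lambda>i. take d (drop (d * i) w)) [0..<m]) = w"
proof -
  have "concat (map (\<lambda>i. take d (drop (d * i) w)) [0..<l]) = take (d * l) w" for l
  proof (induction l)
    case (Suc l)
    then show ?case using take_add[of "d * l" d w] by (simp add: add.commute)
  qed simp
  from this[of m] assms show ?thesis by simp
qed

text \<open>Serves to exhibit \<open>w\<close> as a \<open>q\<close>-th power once its blocks are
  known to repeat with period \<open>r\<close>.\<close>

lemma concat_map_upt_periodic:
  assumes "\<And>i. f (i + r) = f i"
  shows "concat (map f [0..<r * q]) = concat (replicate q (concat (map f [0..<r])))"
proof (induction q)
  case (Suc q)
  have shift_q: "f (i + r * q) = f i" for i
  proof (induction q)
    case (Suc q)
    have "f (i + r * Suc q) = f (i + r * q + r)" by (simp add: algebra_simps)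
    then show ?case using assms Suc by metis
  qed simp
  have "[r * q..<r * Suc q] = map (\<lambda>i. i + r * q) [0..<r]"
    by (simp add: map_add_upt add.commute)
  then have "map f [r * q..<r * Suc q] = map f [0..<r]"
    by (simp add: shift_q)
  moreover have "[0..<r * Suc q] = [0..<r * q] @ [r * q..<r * Suc q]"
    using upt_add_eq_append[of 0 "r * q" r] by (simp add: add.commute)
  ultimately have "concat (map f [0..<r * Suc q])
      = concat (replicate q (concat (map f [0..<r]))) @ concat (map f [0..<r])"
    using Suc by (simp only: map_append concat_append)
  also have "\<dots> = concat (replicate (Suc q) (concat (map f [0..<r])))"
    by (simp flip: replicate_append_same)
  finally show ?case .
qed simp

theorem theorem3p2:
  fixes n k j t :: nat and w :: "nat word"
  assumes "n \<ge> 1"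
    and "w \<in> carrier (F n)"
    and "w \<noteq> []"
    and "cyclically_reduced w"
    and "length w = k"
    and "\<not> proper_power (F n) w"
    and "j < n"
    and "t < k"
    and "(shift n ^^ j) w = (rotate1 ^^ t) w"
  shows "\<exists>h<n. w = foldr (\<lambda>a b. a \<otimes>\<^bsub>F n\<^esub> b)
           (map (\<lambda>i. (shift n ^^ (i * h)) (take (gcd k t) w)) [0..<n div gcd n h]) \<one>\<^bsub>F n\<^esub>"
proof -
  note w = assms(2)
  have red: "reduced w" using w by (simp add: free_group_def)
  define d where "d = gcd k t"
  have "d > 0" using assms(8) by (simp add: d_def)
  obtain m where m: "k = d * m" unfolding d_def by (meson dvd_def gcd_dvd1)
  \<comment> \<open>A Bezout coefficient of \<open>t\<close> modulo \<open>k\<close>; for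
    \<open>t = 0\<close> one has \<open>d = k\<close> and the congruence is trivial.\<close>
  obtain a where a: "[t * a = d] (mod k)"
    using cong_solve_nat[of t k] by (auto simp: d_def gcd.commute)
  define h where "h = (a * j) mod n"
  define r where "r = n div gcd n h"
  have "h < n" using assms(1) by (simp add: h_def)
  have "(shift n ^^ h) w = (shift n ^^ (a * j)) w"
    by (rule shift_funpow_cong[OF w]) (simp add: h_def cong_def)
  also have "\<dots> = rotate (a * t) w"
    by (rule shift_eq_rotate_mult) (use assms(9) in \<open>simp add: rotate_def\<close>)
  also have "\<dots> = rotate d w"
    using a assms(5) by (metis cong_def mult.commute rotate_conv_mod)
  finally have rot: "(shift n ^^ (i * h)) w = rotate (i * d) w" for i
    by (rule shift_eq_rotate_mult)

  define u where "u = take d w"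
  define f where "f i = (shift n ^^ (i * h)) u" for i
  have u: "u \<in> carrier (F n)"
    using w reduced_append1[of u "drop d w"] set_take_subset[of d w]
    by (auto simp: u_def free_group_def)
  have block: "take d (drop (d * i) w) = f i" if "i < m" for i
  proof -
    have "d * (i + 1) \<le> d * m" using that by (intro mult_le_mono2) simp
    then have "d + d * i \<le> length w" using m assms(5) by simp
    \<comment> \<open>Since \<open>i * d < length w\<close>, the rotation does not wrap round. At
      least \<open>d\<close> letters follow the cut, so the rotated word begins with the whole
      \<open>i\<close>-th block.\<close>
    moreover from this \<open>d > 0\<close> have "rotate (i * d) w = drop (d * i) w @ take (d * i) w"
      by (simp add: rotate_drop_take mult.commute)
    ultimately have "take d (drop (d * i) w) = take d (rotate (i * d) w)" by simp
    then show ?thesis by (simp add: f_def u_def take_shift flip: rot)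
  qed
  have w_eq: "w = concat (map f [0..<m])"
  proof -
    have "w = concat (map (\<lambda>i. take d (drop (d * i) w)) [0..<m])"
      using concat_blocks[of w d m] m assms(5) by simp
    also have "\<dots> = concat (map f [0..<m])"
      by (intro arg_cong[of _ _ concat] map_cong) (simp_all add: block)
    finally show ?thesis .
  qed

  \<comment> \<open>Rotating by \<open>m * d = k\<close> is a full turn.\<close>
  have "(shift n ^^ (m * h)) w = w"
    using rot[of m] m assms(5) by (simp add: mult.commute rotate_conv_mod[of "d * m"])
  then have "n dvd m * h" by (rule shift_funpow_fix_imp_dvd[OF w assms(3)])
  \<comment> \<open>The factor \<open>m\<close> comes out of the gcd; dividing by
    \<open>gcd n h\<close> then leaves \<open>r dvd m\<close>.\<close>
  then have "n dvd gcd (m * n) (m * h)" by simp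
  then have "n dvd m * gcd n h" by (simp only: gcd_mult_distrib_nat)
  then have "r dvd m"
    using assms(1) by (simp add: r_def div_dvd_iff_mult)
  then obtain q where q: "m = r * q" by blast
  \<comment> \<open>\<open>r * h\<close> is the lcm of \<open>n\<close> and \<open>h\<close>, so
    \<open>r\<close> more blocks shift by a multiple of \<open>n\<close>, which is trivial on
    \<open>u\<close>.\<close>
  have "r * h = n * (h div gcd n h)"
    by (simp add: r_def div_mult_swap dvd_div_mult)
  then have "(i + r) * h = i * h + n * (h div gcd n h)" for i
    by (simp add: add_mult_distrib)
  then have "f (i + r) = f i" for i
    unfolding f_def by (intro shift_funpow_cong[OF u]) (simp add: cong_def)
  then have w_pow: "w = concat (replicate q (concat (map f [0..<r])))"
    using w_eq q concat_map_upt_periodic[of f r q] by simp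
  have "q \<noteq> 0" using w_pow assms(3) by auto
  moreover have "\<not> q \<ge> 2"
  proof
    assume "q \<ge> 2"
    define v where "v = concat (map f [0..<r])"
    \<comment> \<open>As a prefix of \<open>w\<close>, the root \<open>v\<close> is reduced and uses
      only letters of \<open>w\<close>.\<close>
    have "w = v @ concat (replicate (q - 1) v)"
      using w_pow \<open>q \<noteq> 0\<close> by (cases q) (auto simp: v_def)
    then have "v \<in> carrier (F n)"
      using w reduced_append1[of v] by (auto simp: free_group_def)
    moreover have "w = v [^]\<^bsub>F n\<^esub> q"
      using nat_pow_eq_concat_replicate[of q v] w_pow red by (simp add: v_def)
    ultimately show False using assms(6) \<open>q \<ge> 2\<close> by (auto simp: proper_power_def)
  qed
  ultimately have "q = 1" by simp
  then have "w = concat (map f [0..<r])" using w_pow by simp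
  then have "w = foldr (\<lambda>a b. a \<otimes>\<^bsub>F n\<^esub> b) (map f [0..<r]) \<one>\<^bsub>F n\<^esub>"
    using mult_list_eq_concat[of "map f [0..<r]"] red by simp
  then show ?thesis
    using \<open>h < n\<close> by (intro exI[of _ h]) (simp add: f_def[abs_def] u_def r_def d_def)
qed

end
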